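(* There exists no function $\varphi\in L_2(\mathbb{R})$ for which there are summable sequences $a,b\in\ell_1(\mathbb{Z})$ such that $$\beta^2=\sum_{k\in\mathbb{Z}} a_k\,\varphi(\cdot-k)\qquad\text{and}\qquad \beta^3=\sum_{k\in\mathbb{Z}} b_k\,\varphi(\cdot-k),$$ where $\beta^2$ and $\beta^3$ are the quadratic and cubic B-splines.
   Context: The polynomial B-spline $\beta^{n}$ of degree $n$ (order $n+1$) is the compactly supported function with Fourier transform $\widehat{\beta^{n}}(\omega)=\left(\frac{1-\mathrm{e}^{-\mathrm{j}\omega}}{\mathrm{j}\omega}\right)^{n+1}$, where $\widehat f(\omega)=\int_{\mathbb{R}} f(t)\mathrm{e}^{-\mathrm{j}\omega t}\,\mathrm{d}t$ and $\mathrm{j}$ is the imaginary unit. The equalities are in $L_2(\mathbb{R})$. *)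

theory Defs
  imports "HOL-Analysis.Analysis"
begin

(* The integral is 0 by convention for non-integrable f. *)
definition fourier :: "(real \<Rightarrow> complex) \<Rightarrow> real \<Rightarrow> complex" where
  "fourier f \<omega> = (LINT t|lborel. f t * exp (- (\<i> * of_real \<omega> * of_real t)))"

(* The predicate holds for every compactly supported representative of the B-spline.
   At \<omega> = 0 the quotient is a removable singularity, whereas division by 0 yields 0 in HOL;
   the transform of an integrable function is continuous, so the other values determine it. *)
definition is_bspline :: "nat \<Rightarrow> (real \<Rightarrow> complex) \<Rightarrow> bool" where
  "is_bspline n f \<longleftrightarrow>
     integrable lborel f \<and> compact (closure {t. f t \<noteq> 0}) \<and>
     (\<forall>\<omega>. \<omega> \<noteq> 0 \<longrightarrow>
        fourier f \<omega> = ((1 - exp (- (\<i> * of_real \<omega>))) / (\<i> * of_real \<omega>)) ^ (n + 1))"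

(* Functions are not identified up to null sets; has_L2_sum depends only on their classes. *)
definition L2 :: "(real \<Rightarrow> complex) set" where
  "L2 = {f \<in> borel_measurable lborel. integrable lborel (\<lambda>t. (cmod (f t))\<^sup>2)}"

definition l1_seq :: "(int \<Rightarrow> complex) \<Rightarrow> bool" where
  "l1_seq a \<longleftrightarrow> (\<lambda>k. cmod (a k)) summable_on UNIV"

(* Convergence in the L2 norm (its square tends to 0) of the finite partial sums of g to f.
   The nonnegative integral avoids the value 0 that the Bochner integral assigns to
   non-integrable functions. *)
definition has_L2_sum :: "(int \<Rightarrow> real \<Rightarrow> complex) \<Rightarrow> (real \<Rightarrow> complex) \<Rightarrow> bool" where
  "has_L2_sum g f \<longleftrightarrow>
     ((\<lambda>F. \<integral>\<^sup>+ t. ennreal ((cmod (f t - (\<Sum>k\<in>F. g k t)))\<^sup>2) \<partial>lborel) \<longlongrightarrow> 0)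
       (finite_subsets_at_top UNIV)"

(* The rest shows that is_bspline n is satisfiable for every n. *)

definition conv :: "(real \<Rightarrow> complex) \<Rightarrow> (real \<Rightarrow> complex) \<Rightarrow> real \<Rightarrow> complex" where
  "conv f g x = (LINT s|lborel. f s * g (x - s))"

lemma integrable_translate:
  fixes g :: "real \<Rightarrow> complex"
  assumes "integrable lborel g"
  shows "integrable lborel (\<lambda>x. g (x - s))"
  using lborel_integrable_real_affine[OF assms, of 1 "-s"] by (simp add: algebra_simps)

lemma integral_translate:
  fixes g :: "real \<Rightarrow> 'a :: {banach, second_countable_topology}"
  shows "(LINT x|lborel. g (x - s)) = (LINT x|lborel. g x)"
  using lborel_integral_real_affine[of 1 g "-s"] by (simp add: algebra_simps)

lemma conv_integrable_prod:
  fixes h :: "real \<Rightarrow> complex"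
  assumes f: "integrable lborel f" and g: "integrable lborel g"
    and h: "continuous_on UNIV h" "\<And>x. cmod (h x) = 1"
  shows "integrable (lborel \<Otimes>\<^sub>M lborel) (\<lambda>(s, x). f s * g (x - s) * h x)"
proof (rule lborel_pair.Fubini_integrable)
  have [measurable]: "f \<in> borel_measurable borel" "g \<in> borel_measurable borel"
      "h \<in> borel_measurable borel"
    using borel_measurable_integrable[OF f] borel_measurable_integrable[OF g] h
    by (auto intro: borel_measurable_continuous_onI)
  show "(\<lambda>(s, x). f s * g (x - s) * h x) \<in> borel_measurable (lborel \<Otimes>\<^sub>M lborel)"
    by measurable
  have "(LINT x|lborel. cmod (case (s, x) of (s, x) \<Rightarrow> f s * g (x - s) * h x))
      = cmod (f s) * (LINT x|lborel. cmod (g x))" for s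
    using integral_translate[of "\<lambda>x. cmod (g x)" s] by (simp add: norm_mult h)
  then show "integrable lborel
      (\<lambda>s. LINT x|lborel. cmod (case (s, x) of (s, x) \<Rightarrow> f s * g (x - s) * h x))"
    using f by simp
  have "integrable lborel (\<lambda>x. f s * g (x - s) * h x)" for s
  proof (rule Bochner_Integration.integrable_bound)
    show "integrable lborel (\<lambda>x. f s * g (x - s))"
      by (intro integrable_mult_right integrable_translate g)
  qed (auto simp: norm_mult h)
  then show "AE s in lborel. integrable lborel (\<lambda>x. case (s, x) of (s, x) \<Rightarrow> f s * g (x - s) * h x)"
    by simp
qed

lemma conv_integrable:
  assumes "integrable lborel f" "integrable lborel g"
  shows "integrable lborel (conv f g)"
  using lborel_pair.integrable_snd[OF conv_integrable_prod[OF assms, of "\<lambda>_. 1"]]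
  by (simp add: conv_def[abs_def])

lemma fourier_conv:
  assumes f: "integrable lborel f" and g: "integrable lborel g"
  shows "fourier (conv f g) \<omega> = fourier f \<omega> * fourier g \<omega>"
proof -
  let ?e = "\<lambda>t. exp (- (\<i> * of_real \<omega> * of_real t)) :: complex"
  have h: "continuous_on UNIV ?e" "\<And>x. cmod (?e x) = 1"
    by (auto intro!: continuous_intros)
  have split: "?e x = ?e s * ?e (x - s)" for x s
    by (simp flip: exp_add add: algebra_simps)
  have "fourier (conv f g) \<omega> = (LINT x|lborel. LINT s|lborel. f s * g (x - s) * ?e x)"
    by (simp add: fourier_def conv_def)
  also have "\<dots> = (LINT s|lborel. LINT x|lborel. f s * g (x - s) * ?e x)"
    by (rule lborel_pair.Fubini_integral[OF conv_integrable_prod[OF f g h]])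
  also have "\<dots> = (LINT s|lborel. LINT x|lborel. (f s * ?e s) * (g (x - s) * ?e (x - s)))"
  proof -
    have "f s * g (x - s) * ?e x = (f s * ?e s) * (g (x - s) * ?e (x - s))" for s x
      unfolding split[of x s] by (simp only: mult_ac)
    then show ?thesis by presburger
  qed
  also have "\<dots> = (LINT s|lborel. (f s * ?e s) * fourier g \<omega>)"
    unfolding integral_mult_right_zero fourier_def
    by (subst integral_translate[of "\<lambda>x. g x * ?e x"]) (rule refl)
  also have "\<dots> = fourier f \<omega> * fourier g \<omega>"
    by (simp add: fourier_def)
  finally show ?thesis .
qed

lemma compact_support_iff:
  fixes f :: "real \<Rightarrow> complex"
  shows "compact (closure {t. f t \<noteq> 0}) \<longleftrightarrow> (\<exists>R. \<forall>t. \<bar>t\<bar> > R \<longrightarrow> f t = 0)"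
  unfolding compact_closure bounded_iff by (auto simp: not_less) (metis not_le)+

lemma conv_compact_support:
  assumes "compact (closure {t. f t \<noteq> 0})" "compact (closure {t. g t \<noteq> 0})"
  shows "compact (closure {t. conv f g t \<noteq> 0})"
proof -
  obtain R S where R: "\<And>t. \<bar>t\<bar> > R \<Longrightarrow> f t = 0" and S: "\<And>t. \<bar>t\<bar> > S \<Longrightarrow> g t = 0"
    using assms unfolding compact_support_iff by blast
  have "conv f g x = 0" if "\<bar>x\<bar> > R + S" for x
  proof -
    have "f s * g (x - s) = 0" for s
    proof (cases "\<bar>s\<bar> > R")
      case False
      then have "\<bar>x - s\<bar> > S" using that by linarith
      then show ?thesis by (simp add: S)
    qed (simp add: R)
    then show ?thesis unfolding conv_def by (simp only: Bochner_Integration.integral_zero)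
  qed
  then show ?thesis unfolding compact_support_iff by blast
qed

lemma is_bspline_0: "is_bspline 0 (indicator {0..1})"
  unfolding is_bspline_def
proof (intro conjI allI impI)
  have "integrable lborel (\<lambda>t::real. complex_of_real (indicator {0..1} t))"
    by (intro integrable_of_real integrable_real_indicator) simp_all
  then show "integrable lborel (indicator {0..1} :: real \<Rightarrow> complex)"
    by (simp add: of_real_indicator)
  show "compact (closure {t::real. (indicator {0..1} t :: complex) \<noteq> 0})"
    unfolding compact_support_iff by (rule exI[of _ 1]) (auto simp: indicator_def)
next
  fix \<omega> :: real
  assume w: "\<omega> \<noteq> 0"
  let ?e = "\<lambda>t. exp (- (\<i> * of_real \<omega> * of_real t)) :: complex"
  let ?F = "\<lambda>t::real. - ?e t / (\<i> * of_real \<omega>)"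
  have "(LINT t|lborel. indicator {0..1} t *\<^sub>R ?e t) = ?F 1 - ?F 0"
  proof (rule integral_FTC_Icc)
    show "continuous_on {0..1} ?e" by (intro continuous_intros)
    fix x :: real
    show "(?F has_vector_derivative ?e x) (at x within {0..1})"
      using w by (auto intro!: derivative_eq_intros has_vector_derivative_real_field
          simp: field_simps)
  qed simp
  also have "\<dots> = (1 - exp (- (\<i> * of_real \<omega>))) / (\<i> * of_real \<omega>)"
    using w by (simp add: field_simps)
  also have "(LINT t|lborel. indicator {0..1} t *\<^sub>R ?e t) = fourier (indicator {0..1}) \<omega>"
    unfolding fourier_def
    by (intro Bochner_Integration.integral_cong) (auto simp: indicator_def)
  finally show "fourier (indicator {0..1}) \<omega>
      = ((1 - exp (- (\<i> * of_real \<omega>))) / (\<i> * of_real \<omega>)) ^ (0 + 1)"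
    by simp
qed

lemma is_bspline_Suc:
  assumes "is_bspline n f"
  shows "is_bspline (Suc n) (conv f (indicator {0..1}))"
  using assms is_bspline_0
  by (simp add: is_bspline_def conv_integrable conv_compact_support fourier_conv
      del: compact_closure)

lemma is_bspline_exists: "\<exists>f. is_bspline n f"
  by (induction n) (use is_bspline_0 is_bspline_Suc in blast)+

end

theory Submission
  imports Defs
begin

text \<open>
  Suppose \<open>\<beta>\<^sup>2\<close> and \<open>\<beta>\<^sup>3\<close> were both \<open>\<ell>\<^sub>1\<close>-combinations of the integer shifts of one \<open>\<phi>\<close>, with
  coefficients \<open>a\<close> and \<open>b\<close>. Filtering the first expansion with \<open>b\<close> and the second with \<open>a\<close> gives
  the same function, since discrete convolution commutes. So \<open>\<phi>\<close> drops out and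

    \<open>\<Sum>\<^sub>k b\<^sub>k \<beta>\<^sup>2(t - k) = \<Sum>\<^sub>k a\<^sub>k \<beta>\<^sup>3(t - k)\<close> for almost all \<open>t\<close>.

  Both sides are now integrable, and the Fourier transform turns this into
  \<open>B(\<omega>) x(\<omega>)\<^sup>3 = A(\<omega>) x(\<omega>)\<^sup>4\<close> with the \<open>2\<pi>\<close>-periodic symbols \<open>A\<close>, \<open>B\<close> of the two sequences and
  \<open>x(\<omega>) = (1 - exp (-i\<omega>)) / (i\<omega>)\<close>. Off the zeros of \<open>x\<close> this reads
  \<open>B(\<omega>) i\<omega> = A(\<omega>) (1 - exp (-i\<omega>))\<close>. Here every factor is periodic except \<open>\<omega>\<close>; comparing the
  equation at \<open>\<omega>\<close> and at \<open>\<omega> + 2\<pi>\<close> forces \<open>B(\<omega>) = 0\<close> outside \<open>2\<pi>\<int>\<close>. Hence \<open>b = 0\<close>, and \<open>\<beta>\<^sup>3\<close> would vanish almost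
  everywhere, although its transform at \<open>\<pi>\<close> is nonzero.

  Eliminating \<open>\<phi>\<close> in the time domain means that no Fourier transform of an \<open>L\<^sub>2\<close> function occurs.
  The elimination rests on Young's inequality for finite filters (\<open>sq_norm_shift_comb_le\<close>), which
  yields \<open>L\<^sub>2\<close> convergence of the difference of the partial sums to 0
  (\<open>cross_shift_comb_tendsto_0\<close>). The compact supports make these partial sums converge
  pointwise as well, and Fatou's lemma identifies the two limits (\<open>AE_eq_of_cross_L2_sums\<close>). The
  other ingredients are the product formula \<open>fourier_shift_series\<close> and the uniqueness of
  Fourier coefficients, \<open>dtft_eq_0_imp_eq_0\<close>.
\<close>

section \<open>Finite shift combinations and the square norm\<close>

text \<open>
  The squared \<open>L\<^sub>2\<close> norm takes the value \<open>\<infinity>\<close> outside \<open>L\<^sub>2\<close>, so that the estimates below make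
  sense for all measurable functions.
\<close>

definition sq_norm :: "(real \<Rightarrow> complex) \<Rightarrow> ennreal" where
  "sq_norm f = (\<integral>\<^sup>+ t. ennreal ((cmod (f t))\<^sup>2) \<partial>lborel)"

definition shift_comb :: "(int \<Rightarrow> complex) \<Rightarrow> int set \<Rightarrow> (real \<Rightarrow> complex) \<Rightarrow> real \<Rightarrow> complex" where
  "shift_comb c F g t = (\<Sum>k\<in>F. c k * g (t - of_int k))"

lemma shift_comb_measurable [measurable]:
  assumes [measurable]: "g \<in> borel_measurable borel"
  shows "shift_comb c F g \<in> borel_measurable borel"
  unfolding shift_comb_def[abs_def] by measurable

lemma has_L2_sum_iff_sq_norm:
  "has_L2_sum (\<lambda>k t. c k * g (t - of_int k)) f \<longleftrightarrow>
     ((\<lambda>F. sq_norm (\<lambda>t. f t - shift_comb c F g t)) \<longlongrightarrow> 0) (finite_subsets_at_top UNIV)"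
  by (simp add: has_L2_sum_def sq_norm_def shift_comb_def)

lemma sq_norm_translate:
  assumes [measurable]: "g \<in> borel_measurable borel"
  shows "sq_norm (\<lambda>t. g (t - s)) = sq_norm g"
  unfolding sq_norm_def
  using nn_integral_real_affine[of "\<lambda>t. ennreal ((cmod (g t))\<^sup>2)" 1 "- s"] by simp

lemma sq_norm_eq_0_iff:
  assumes [measurable]: "g \<in> borel_measurable borel"
  shows "sq_norm g = 0 \<longleftrightarrow> (AE t in lborel. g t = 0)"
  unfolding sq_norm_def by (subst nn_integral_0_iff_AE) auto

text \<open>
  The pointwise bound \<open>\<bar>x - y\<bar>\<^sup>2 \<le> 2 \<bar>x\<bar>\<^sup>2 + 2 \<bar>y\<bar>\<^sup>2\<close>, integrated. For limits that are 0 it does the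
  work of Minkowski's inequality.
\<close>

lemma sq_norm_diff_le:
  assumes [measurable]: "f \<in> borel_measurable borel" "g \<in> borel_measurable borel"
  shows "sq_norm (\<lambda>t. f t - g t) \<le> 2 * sq_norm f + 2 * sq_norm g"
proof -
  have "(cmod (f t - g t))\<^sup>2 \<le> 2 * (cmod (f t))\<^sup>2 + 2 * (cmod (g t))\<^sup>2" for t
  proof -
    have "(cmod (f t - g t))\<^sup>2 \<le> (cmod (f t) + cmod (g t))\<^sup>2"
      by (intro power_mono norm_triangle_ineq4) simp
    also have "\<dots> \<le> 2 * (cmod (f t))\<^sup>2 + 2 * (cmod (g t))\<^sup>2"
      using sum_squares_bound[of "cmod (f t)" "cmod (g t)"] by (simp add: power2_sum)
    finally show ?thesis .
  qed
  then have "sq_norm (\<lambda>t. f t - g t)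
      \<le> (\<integral>\<^sup>+ t. 2 * ennreal ((cmod (f t))\<^sup>2) + 2 * ennreal ((cmod (g t))\<^sup>2) \<partial>lborel)"
    unfolding sq_norm_def
    by (intro nn_integral_mono) (simp add: ennreal_mult'[symmetric] flip: ennreal_plus ennreal_numeral)
  also have "\<dots> = 2 * sq_norm f + 2 * sq_norm g"
    unfolding sq_norm_def by (simp add: nn_integral_add nn_integral_cmult)
  finally show ?thesis .
qed

text \<open>
  Young's inequality \<open>\<parallel>c * g\<parallel>\<^sub>2 \<le> \<parallel>c\<parallel>\<^sub>1 \<parallel>g\<parallel>\<^sub>2\<close>. Splitting each weight as \<open>\<bar>c\<^sub>k\<bar> = \<bar>c\<^sub>k\<bar>\<^bsup>1/2\<^esup> \<bar>c\<^sub>k\<bar>\<^bsup>1/2\<^esup>\<close> in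
  Cauchy--Schwarz gives a pointwise bound that is linear in the translates of \<open>\<bar>g\<bar>\<^sup>2\<close>, and these
  all have the same integral.
\<close>

lemma sq_norm_shift_comb_le:
  assumes [measurable]: "g \<in> borel_measurable borel"
  shows "sq_norm (shift_comb c F g) \<le> ennreal ((\<Sum>k\<in>F. cmod (c k))\<^sup>2) * sq_norm g"
proof -
  let ?C = "\<Sum>k\<in>F. cmod (c k)"
  have C: "?C \<ge> 0" by (simp add: sum_nonneg)
  have "(cmod (shift_comb c F g t))\<^sup>2 \<le> ?C * (\<Sum>k\<in>F. cmod (c k) * (cmod (g (t - of_int k)))\<^sup>2)" for t
  proof -
    have "cmod (shift_comb c F g t)
        \<le> (\<Sum>k\<in>F. sqrt (cmod (c k)) * (sqrt (cmod (c k)) * cmod (g (t - of_int k))))"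
      unfolding shift_comb_def
      by (rule order_trans[OF norm_sum]) (simp add: norm_mult flip: mult.assoc)
    then have "(cmod (shift_comb c F g t))\<^sup>2
        \<le> (\<Sum>k\<in>F. sqrt (cmod (c k)) * (sqrt (cmod (c k)) * cmod (g (t - of_int k))))\<^sup>2"
      by (intro power_mono) auto
    also have "\<dots> \<le> (\<Sum>k\<in>F. (sqrt (cmod (c k)))\<^sup>2)
        * (\<Sum>k\<in>F. (sqrt (cmod (c k)) * cmod (g (t - of_int k)))\<^sup>2)"
      by (rule Cauchy_Schwarz_ineq_sum)
    finally show ?thesis by (simp add: power_mult_distrib)
  qed
  then have "sq_norm (shift_comb c F g) \<le> (\<integral>\<^sup>+ t. ennreal ?C *
      (\<Sum>k\<in>F. ennreal (cmod (c k)) * ennreal ((cmod (g (t - of_int k)))\<^sup>2)) \<partial>lborel)"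
    unfolding sq_norm_def using C
    by (intro nn_integral_mono)
       (auto simp: ennreal_mult'[symmetric] sum_ennreal sum_nonneg intro!: ennreal_leI)
  also have "\<dots> = ennreal ?C *
      (\<Sum>k\<in>F. ennreal (cmod (c k)) * sq_norm (\<lambda>t. g (t - of_int k)))"
    unfolding sq_norm_def by (simp add: nn_integral_cmult nn_integral_sum)
  also have "\<dots> = ennreal ?C * (ennreal ?C * sq_norm g)"
    by (simp add: sq_norm_translate sum_ennreal flip: sum_distrib_right)
  also have "\<dots> = ennreal (?C\<^sup>2) * sq_norm g"
    using C by (simp add: power2_eq_square ennreal_mult mult.assoc)
  finally show ?thesis .
qed

lemma shift_comb_commute:
  "shift_comb b G (shift_comb a F \<phi>) = shift_comb a F (shift_comb b G \<phi>)"
proof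
  fix t :: real
  show "shift_comb b G (shift_comb a F \<phi>) t = shift_comb a F (shift_comb b G \<phi>) t"
    unfolding shift_comb_def sum_distrib_left
    by (subst sum.swap) (simp add: algebra_simps)
qed

lemma shift_comb_diff:
  "shift_comb c F (\<lambda>t. f t - g t) t = shift_comb c F f t - shift_comb c F g t"
  by (simp add: shift_comb_def right_diff_distrib sum_subtractf)

text \<open>
  Elimination of the common generator. If \<open>e\<close> and \<open>e'\<close> are the errors of the partial expansions of
  \<open>f\<close> and \<open>g\<close> over the index set \<open>F\<close>, then the contributions of \<open>\<phi>\<close> to \<open>b * f\<close> and \<open>a * g\<close> cancel,
  because the filters commute. What remains is \<open>b * e - a * e'\<close>, which Young's inequality bounds
  by the errors, uniformly in \<open>F\<close>.
\<close>

lemma cross_shift_comb_tendsto_0: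
  assumes [measurable]: "f \<in> borel_measurable borel" "g \<in> borel_measurable borel"
      "\<phi> \<in> borel_measurable borel"
    and a: "l1_seq a" and b: "l1_seq b"
    and f: "has_L2_sum (\<lambda>k t. a k * \<phi> (t - of_int k)) f"
    and g: "has_L2_sum (\<lambda>k t. b k * \<phi> (t - of_int k)) g"
  shows "((\<lambda>F. sq_norm (\<lambda>t. shift_comb b F f t - shift_comb a F g t)) \<longlongrightarrow> 0)
      (finite_subsets_at_top UNIV)"
proof -
  define N where "N c = ennreal ((\<Sum>\<^sub>\<infinity>k. cmod (c k))\<^sup>2)" for c :: "int \<Rightarrow> complex"
  have young: "sq_norm (shift_comb c F h) \<le> N c * sq_norm h"
    if "l1_seq c" "finite F" and [measurable]: "h \<in> borel_measurable borel" for c F h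
  proof -
    have "(\<Sum>k\<in>F. cmod (c k)) \<le> (\<Sum>\<^sub>\<infinity>k. cmod (c k))"
      using that by (intro finite_sum_le_infsum) (auto simp: l1_seq_def)
    then have "(\<Sum>k\<in>F. cmod (c k))\<^sup>2 \<le> (\<Sum>\<^sub>\<infinity>k. cmod (c k))\<^sup>2"
      by (intro power_mono) (auto simp: sum_nonneg)
    then have "ennreal ((\<Sum>k\<in>F. cmod (c k))\<^sup>2) \<le> N c"
      unfolding N_def by (rule ennreal_leI)
    then show ?thesis
      by (rule order_trans[OF sq_norm_shift_comb_le[OF that(3)] mult_right_mono]) simp
  qed
  let ?ef = "\<lambda>F t. f t - shift_comb a F \<phi> t" and ?eg = "\<lambda>F t. g t - shift_comb b F \<phi> t"
  have bound: "sq_norm (\<lambda>t. shift_comb b F f t - shift_comb a F g t)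
      \<le> 2 * (N b * sq_norm (?ef F)) + 2 * (N a * sq_norm (?eg F))" if "finite F" for F
  proof -
    have "(\<lambda>t. shift_comb b F f t - shift_comb a F g t)
        = (\<lambda>t. shift_comb b F (?ef F) t - shift_comb a F (?eg F) t)"
      by (simp add: shift_comb_diff shift_comb_commute[of b F a F \<phi>])
    then have "sq_norm (\<lambda>t. shift_comb b F f t - shift_comb a F g t)
        \<le> 2 * sq_norm (shift_comb b F (?ef F)) + 2 * sq_norm (shift_comb a F (?eg F))"
      by (simp add: sq_norm_diff_le)
    also have "\<dots> \<le> 2 * (N b * sq_norm (?ef F)) + 2 * (N a * sq_norm (?eg F))"
      using that a b by (intro add_mono mult_left_mono young) auto
    finally show ?thesis .
  qed
  have "((\<lambda>F. 2 * (N b * sq_norm (?ef F)) + 2 * (N a * sq_norm (?eg F)))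
      \<longlongrightarrow> 2 * (N b * 0) + 2 * (N a * 0)) (finite_subsets_at_top UNIV)"
    using f g unfolding has_L2_sum_iff_sq_norm
    by (intro tendsto_add ennreal_tendsto_cmult) (auto simp: N_def)
  then have lim: "((\<lambda>F. 2 * (N b * sq_norm (?ef F)) + 2 * (N a * sq_norm (?eg F)))
      \<longlongrightarrow> 0) (finite_subsets_at_top UNIV)" by simp
  show ?thesis
    by (rule tendsto_sandwich[OF _ _ tendsto_const lim])
       (auto intro!: bound eventually_finite_subsets_at_top_weakI)
qed

section \<open>The symbol of a summable sequence\<close>

text \<open>
  The integers are enumerated by \<open>int_decode\<close>, so that the theorems on series indexed by natural
  numbers, in particular integration term by term, apply.
\<close>

definition dtft :: "(int \<Rightarrow> complex) \<Rightarrow> real \<Rightarrow> complex" where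
  "dtft c \<omega> = (\<Sum>i. c (int_decode i) * exp (- (\<i> * of_real \<omega> * of_int (int_decode i))))"

lemma l1_seq_summable_norm:
  assumes "l1_seq c"
  shows "summable (\<lambda>i. cmod (c (int_decode i)))"
proof -
  have "(\<lambda>k. cmod (c k)) summable_on int_decode ` UNIV"
    using assms by (simp add: l1_seq_def surj_int_decode)
  then have "((\<lambda>k. cmod (c k)) \<circ> int_decode) summable_on UNIV"
    by (subst (asm) summable_on_reindex) (auto simp: inj_int_decode)
  then show ?thesis by (intro summable_on_UNIV_nonneg_real_iff[THEN iffD1]) (auto simp: o_def)
qed

lemma dtft_sums:
  assumes "l1_seq c"
  shows "(\<lambda>i. c (int_decode i) * exp (- (\<i> * of_real \<omega> * of_int (int_decode i)))) sums dtft c \<omega>"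
  unfolding dtft_def
  by (rule summable_sums[OF summable_norm_cancel])
     (use l1_seq_summable_norm[OF assms] in \<open>simp add: norm_mult\<close>)

lemma exp_int_frequency_periodic:
  "exp (- (\<i> * of_real (\<omega> + 2 * pi) * of_int k)) = exp (- (\<i> * of_real \<omega> * of_int k))"
proof -
  have "- (\<i> * of_real (\<omega> + 2 * pi) * of_int k)
      = - (\<i> * of_real \<omega> * of_int k) + \<i> * (of_int (- k) * (of_real pi * 2))"
    by (simp add: algebra_simps)
  then show ?thesis by (simp only: exp_plus_2pin)
qed

lemma dtft_periodic: "dtft c (\<omega> + 2 * pi) = dtft c \<omega>"
  unfolding dtft_def exp_int_frequency_periodic ..

lemma integral_exp_int_period:
  "(LINT x|lborel. indicator {0..2 * pi} x *\<^sub>R exp (\<i> * of_int n * of_real x))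
     = (if n = 0 then 2 * pi else 0)"
proof (cases "n = 0")
  case False
  let ?F = "\<lambda>x::real. exp (\<i> * of_int n * of_real x) / (\<i> * of_int n)"
  have "(LINT x|lborel. indicator {0..2 * pi} x *\<^sub>R exp (\<i> * of_int n * of_real x))
      = ?F (2 * pi) - ?F 0"
  proof (rule integral_FTC_Icc)
    show "continuous_on {0..2 * pi} (\<lambda>x. exp (\<i> * of_int n * of_real x))"
      by (intro continuous_intros)
    fix x :: real
    show "(?F has_vector_derivative exp (\<i> * of_int n * of_real x)) (at x within {0..2 * pi})"
      using False by (auto intro!: derivative_eq_intros has_vector_derivative_real_field)
  qed simp
  moreover have "exp (\<i> * of_int n * of_real (2 * pi)) = 1"
    by (auto simp: exp_eq_1)
  ultimately show ?thesis using False by simp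
qed (simp add: scaleR_conv_of_real)

text \<open>
  The sequence consists of the Fourier coefficients of its symbol: multiplying by \<open>exp (ik\<omega>)\<close> and
  integrating term by term over a period leaves \<open>2\<pi> c\<^sub>k\<close>, by orthogonality of the exponentials.
\<close>

lemma dtft_eq_0_imp_eq_0:
  assumes c: "l1_seq c" and zero: "\<And>\<omega>. 0 < \<omega> \<Longrightarrow> \<omega> < 2 * pi \<Longrightarrow> dtft c \<omega> = 0"
  shows "c k = 0"
proof -
  let ?f = "\<lambda>i x. indicator {0..2 * pi} x *\<^sub>R
    (c (int_decode i) * exp (\<i> * of_int (k - int_decode i) * of_real x))"
  have norm_f: "norm (?f i x) = indicator {0..2 * pi} x *\<^sub>R cmod (c (int_decode i))" for i x
    by (auto simp: indicator_def norm_mult)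
  have int_f: "(LINT x|lborel. ?f i x) = (if i = int_encode k then 2 * pi * c k else 0)" for i
  proof -
    have "(LINT x|lborel. ?f i x) = c (int_decode i) * (LINT x|lborel. indicator {0..2 * pi} x *\<^sub>R
        exp (\<i> * of_int (k - int_decode i) * of_real x))"
      by (subst integral_mult_right_zero[symmetric])
         (intro Bochner_Integration.integral_cong, auto simp: scaleR_conv_of_real)
    moreover have "k - int_decode i = 0 \<longleftrightarrow> i = int_encode k" by auto
    ultimately show ?thesis unfolding integral_exp_int_period by simp
  qed
  have "(\<lambda>i. LINT x|lborel. ?f i x) sums (LINT x|lborel. (\<Sum>i. ?f i x))"
  proof (rule sums_integral)
    show "integrable lborel (?f i)" for i
      by (intro borel_integrable_compact continuous_intros) auto
    show "AE x in lborel. summable (\<lambda>i. norm (?f i x))"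
      unfolding norm_f using l1_seq_summable_norm[OF c] by (auto intro: summable_mult)
    show "summable (\<lambda>i. LINT x|lborel. norm (?f i x))"
      unfolding norm_f using l1_seq_summable_norm[OF c] by (auto intro: summable_mult)
  qed
  moreover have "(\<lambda>i. LINT x|lborel. ?f i x) sums (2 * pi * c k)"
    unfolding int_f by (rule sums_single)
  moreover have "(LINT x|lborel. (\<Sum>i. ?f i x)) = 0"
  proof -
    have "(\<Sum>i. ?f i x) = indicator {0..2 * pi} x *\<^sub>R (exp (\<i> * of_int k * of_real x) * dtft c x)" for x
    proof -
      have f_eq: "?f i x = indicator {0..2 * pi} x *\<^sub>R (exp (\<i> * of_int k * of_real x) *
          (c (int_decode i) * exp (- (\<i> * of_real x * of_int (int_decode i)))))" for i
      proof -
        have "\<i> * of_int (k - int_decode i) * of_real x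
            = \<i> * of_int k * of_real x + - (\<i> * of_real x * of_int (int_decode i))"
          by (simp add: algebra_simps)
        then show ?thesis by (simp only: exp_add mult_ac)
      qed
      show ?thesis
        unfolding f_eq
        by (rule sums_unique[symmetric]) (intro sums_scaleR_right sums_mult dtft_sums c)
    qed
    moreover have "AE x in lborel. indicator {0..2 * pi} x *\<^sub>R
        (exp (\<i> * of_int k * of_real x) * dtft c x) = 0"
      using AE_lborel_singleton[of 0] AE_lborel_singleton[of "2 * pi"]
    proof eventually_elim
      case (elim x)
      then show ?case
        by (cases "x \<in> {0..2 * pi}") (simp_all add: zero order_less_le)
    qed
    ultimately have "AE x in lborel. (\<Sum>i. ?f i x) = 0" by simp
    then show ?thesis by (rule integral_eq_zero_AE)
  qed
  ultimately have "2 * pi * c k = 0" by (simp add: sums_iff)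
  then show ?thesis by simp
qed

section \<open>Shift series of compactly supported functions\<close>

lemma fourier_translate:
  "fourier (\<lambda>t. f (t - s)) \<omega> = exp (- (\<i> * of_real \<omega> * of_real s)) * fourier f \<omega>"
proof -
  let ?e = "\<lambda>t. exp (- (\<i> * of_real \<omega> * of_real t)) :: complex"
  have "f (t - s) * ?e t = ?e s * (f (t - s) * ?e (t - s))" for t
  proof -
    have "?e t = ?e s * ?e (t - s)" by (simp flip: exp_add add: algebra_simps)
    then show ?thesis by simp
  qed
  then have "fourier (\<lambda>t. f (t - s)) \<omega> = ?e s * (LINT t|lborel. f (t - s) * ?e (t - s))"
    unfolding fourier_def by (simp only: integral_mult_right_zero)
  also have "(LINT t|lborel. f (t - s) * ?e (t - s)) = fourier f \<omega>"
    unfolding fourier_def by (rule integral_translate)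
  finally show ?thesis .
qed

text \<open>
  For a fixed argument only finitely many shifts of the support contain it, so the series is a
  finite sum whatever the coefficients are.
\<close>

lemma shift_series_summable:
  fixes f :: "real \<Rightarrow> complex"
  assumes "compact (closure {t. f t \<noteq> 0})"
  shows "summable (\<lambda>i. norm (c (int_decode i) * f (t - of_int (int_decode i))))"
proof -
  obtain R where R: "\<And>t. \<bar>t\<bar> > R \<Longrightarrow> f t = 0"
    using assms unfolding compact_support_iff by blast
  show ?thesis
  proof (rule summable_finite)
    show "finite (int_encode ` {\<lfloor>t - R\<rfloor>..\<lceil>t + R\<rceil>})" by simp
    fix i assume i: "i \<notin> int_encode ` {\<lfloor>t - R\<rfloor>..\<lceil>t + R\<rceil>}"
    then have "int_decode i \<notin> {\<lfloor>t - R\<rfloor>..\<lceil>t + R\<rceil>}"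
      by (metis image_eqI int_decode_inverse)
    then have "\<bar>t - of_int (int_decode i)\<bar> > R" by (auto simp: not_le) linarith+
    then show "norm (c (int_decode i) * f (t - of_int (int_decode i))) = 0" by (simp add: R)
  qed
qed

lemma fourier_shift_series:
  assumes f: "integrable lborel f" "compact (closure {t. f t \<noteq> 0})" and c: "l1_seq c"
  shows "fourier (\<lambda>t. \<Sum>i. c (int_decode i) * f (t - of_int (int_decode i))) \<omega>
      = dtft c \<omega> * fourier f \<omega>"
proof -
  let ?g = "\<lambda>i t. c (int_decode i) * f (t - of_int (int_decode i))"
  let ?u = "\<lambda>t. \<Sum>i. ?g i t"
  have int_g: "integrable lborel (?g i)" for i
    by (intro integrable_mult_right integrable_translate f)
  have summ: "summable (\<lambda>i. norm (?g i t))" for t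
    by (rule shift_series_summable[OF f(2)])
  have norms: "(LINT t|lborel. norm (?g i t)) = cmod (c (int_decode i)) * (LINT t|lborel. norm (f t))" for i
    using integral_translate[of "\<lambda>t. norm (f t)"] by (simp add: norm_mult)
  have summ_int: "summable (\<lambda>i. LINT t|lborel. norm (?g i t))"
    unfolding norms by (intro summable_mult2 l1_seq_summable_norm c)
  let ?e = "\<lambda>t. exp (- (\<i> * of_real \<omega> * of_real t)) :: complex"
  have ne: "norm (?g i t * ?e t) = norm (?g i t)" for i t by (simp add: norm_mult)
  have [measurable]: "f \<in> borel_measurable borel" using borel_measurable_integrable[OF f(1)] by simp
  have "(\<lambda>i. LINT t|lborel. ?g i t * ?e t) sums (LINT t|lborel. (\<Sum>i. ?g i t * ?e t))"
  proof (rule sums_integral)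
    show "integrable lborel (\<lambda>t. ?g i t * ?e t)" for i
      by (rule Bochner_Integration.integrable_bound[OF int_g[of i]])
         (auto simp: ne)
  qed (use summ summ_int in \<open>auto simp only: ne\<close>)
  also have "(\<lambda>t. \<Sum>i. ?g i t * ?e t) = (\<lambda>t. ?u t * ?e t)"
    by (intro ext suminf_mult2[symmetric] summable_norm_cancel[OF summ])
  also have "(\<lambda>i. LINT t|lborel. ?g i t * ?e t)
      = (\<lambda>i. c (int_decode i) * ?e (of_int (int_decode i)) * fourier f \<omega>)"
    using fourier_translate[of f _ \<omega>] by (simp add: fourier_def mult.assoc)
  finally have "(\<lambda>i. c (int_decode i) * ?e (of_int (int_decode i)) * fourier f \<omega>) sums fourier ?u \<omega>"
    unfolding fourier_def .
  moreover have "(\<lambda>i. c (int_decode i) * ?e (of_int (int_decode i)) * fourier f \<omega>)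
      sums (dtft c \<omega> * fourier f \<omega>)"
    using sums_mult2[OF dtft_sums[OF c]] by simp
  ultimately show ?thesis by (rule sums_unique2)
qed

lemma filterlim_int_decode_image:
  "filterlim (\<lambda>n. int_decode ` {..<n}) (finite_subsets_at_top UNIV) sequentially"
  unfolding filterlim_finite_subsets_at_top
proof (intro allI impI)
  fix X :: "int set"
  assume "finite X \<and> X \<subseteq> UNIV"
  then obtain n where n: "int_encode ` X \<subseteq> {..<n}"
    by (metis finite_imageI finite_nat_iff_bounded)
  have "X \<subseteq> int_decode ` {..<m}" if "m \<ge> n" for m
  proof
    fix x assume "x \<in> X"
    then have "int_encode x < m" using n that by auto
    then show "x \<in> int_decode ` {..<m}" by (metis imageI int_encode_inverse lessThan_iff)
  qed
  then show "\<forall>\<^sub>F m in sequentially. finite (int_decode ` {..<m}) \<and> X \<subseteq> int_decode ` {..<m}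
      \<and> int_decode ` {..<m} \<subseteq> UNIV"
    by (auto simp: eventually_sequentially)
qed

text \<open>
  The partial sums of the difference converge pointwise to the difference of the two series and, by
  hypothesis, in \<open>L\<^sub>2\<close> to 0. By Fatou's lemma the square norm of the pointwise limit is at most the
  limit of the square norms.
\<close>

lemma AE_eq_of_cross_L2_sums:
  assumes f: "integrable lborel f" "compact (closure {t. f t \<noteq> 0})"
    and g: "integrable lborel g" "compact (closure {t. g t \<noteq> 0})"
    and lim: "((\<lambda>F. sq_norm (\<lambda>t. shift_comb b F f t - shift_comb a F g t)) \<longlongrightarrow> 0)
      (finite_subsets_at_top UNIV)"
  shows "AE t in lborel. (\<Sum>i. b (int_decode i) * f (t - of_int (int_decode i)))
      = (\<Sum>i. a (int_decode i) * g (t - of_int (int_decode i)))"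
proof -
  have [measurable]: "f \<in> borel_measurable borel" "g \<in> borel_measurable borel"
    using borel_measurable_integrable[OF f(1)] borel_measurable_integrable[OF g(1)] by auto
  let ?F = "\<lambda>n. int_decode ` {..<n}"
  define D where "D n t = shift_comb b (?F n) f t - shift_comb a (?F n) g t" for n t
  define u where "u t = (\<Sum>i. b (int_decode i) * f (t - of_int (int_decode i)))
      - (\<Sum>i. a (int_decode i) * g (t - of_int (int_decode i)))" for t
  have [measurable]: "D n \<in> borel_measurable borel" for n
    unfolding D_def by measurable
  have [measurable]: "u \<in> borel_measurable borel"
    unfolding u_def by measurable
  have D_lim: "(\<lambda>n. D n t) \<longlonglongrightarrow> u t" for t
  proof -
    have inj: "inj_on int_decode A" for A by (rule inj_int_decode)
    have "D n t = (\<Sum>i<n. b (int_decode i) * f (t - of_int (int_decode i)))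
        - (\<Sum>i<n. a (int_decode i) * g (t - of_int (int_decode i)))" for n
      by (simp add: D_def shift_comb_def sum.reindex[OF inj])
    then show ?thesis unfolding u_def
      using shift_series_summable[OF f(2), of b t] shift_series_summable[OF g(2), of a t]
      by (auto intro!: tendsto_diff summable_LIMSEQ dest!: summable_norm_cancel)
  qed
  have "sq_norm u = (\<integral>\<^sup>+ t. liminf (\<lambda>n. ennreal ((cmod (D n t))\<^sup>2)) \<partial>lborel)"
    unfolding sq_norm_def
  proof (intro nn_integral_cong)
    fix t
    have "(\<lambda>n. ennreal ((cmod (D n t))\<^sup>2)) \<longlonglongrightarrow> ennreal ((cmod (u t))\<^sup>2)"
      by (intro tendsto_ennrealI tendsto_power tendsto_norm D_lim)
    then show "ennreal ((cmod (u t))\<^sup>2) = liminf (\<lambda>n. ennreal ((cmod (D n t))\<^sup>2))"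
      by (intro lim_imp_Liminf[symmetric]) simp_all
  qed
  also have "\<dots> \<le> liminf (\<lambda>n. sq_norm (D n))"
    unfolding sq_norm_def by (rule nn_integral_liminf) measurable
  also have "\<dots> = 0"
    using filterlim_compose[OF lim filterlim_int_decode_image]
    by (intro lim_imp_Liminf) (simp_all add: D_def[abs_def])
  finally have "AE t in lborel. u t = 0" by (simp add: sq_norm_eq_0_iff)
  then show ?thesis by (simp add: u_def)
qed

section \<open>Quadratic and cubic B-splines have no common generator\<close>

theorem proposition4:
  fixes \<beta>2 \<beta>3 :: "real \<Rightarrow> complex"
  assumes "is_bspline 2 \<beta>2" and "is_bspline 3 \<beta>3"
  shows "\<not> (\<exists>\<phi>\<in>L2. \<exists>a b :: int \<Rightarrow> complex. l1_seq a \<and> l1_seq b \<and>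
           has_L2_sum (\<lambda>k t. a k * \<phi> (t - of_int k)) \<beta>2 \<and>
           has_L2_sum (\<lambda>k t. b k * \<phi> (t - of_int k)) \<beta>3)"
proof
  assume "\<exists>\<phi>\<in>L2. \<exists>a b :: int \<Rightarrow> complex. l1_seq a \<and> l1_seq b \<and>
           has_L2_sum (\<lambda>k t. a k * \<phi> (t - of_int k)) \<beta>2 \<and>
           has_L2_sum (\<lambda>k t. b k * \<phi> (t - of_int k)) \<beta>3"
  then obtain \<phi> a b where \<phi>: "\<phi> \<in> L2" and a: "l1_seq a" and b: "l1_seq b"
    and sum2: "has_L2_sum (\<lambda>k t. a k * \<phi> (t - of_int k)) \<beta>2"
    and sum3: "has_L2_sum (\<lambda>k t. b k * \<phi> (t - of_int k)) \<beta>3" by blast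
  have \<beta>2: "integrable lborel \<beta>2" "compact (closure {t. \<beta>2 t \<noteq> 0})"
    and \<beta>3: "integrable lborel \<beta>3" "compact (closure {t. \<beta>3 t \<noteq> 0})"
    using assms unfolding is_bspline_def by blast+
  have [measurable]: "\<phi> \<in> borel_measurable borel" "\<beta>2 \<in> borel_measurable borel"
      "\<beta>3 \<in> borel_measurable borel"
    using \<phi> borel_measurable_integrable[OF \<beta>2(1)] borel_measurable_integrable[OF \<beta>3(1)]
    by (auto simp: L2_def)
  define x where "x \<omega> = (1 - exp (- (\<i> * of_real \<omega>))) / (\<i> * of_real \<omega>)" for \<omega> :: real
  have ft2: "fourier \<beta>2 \<omega> = x \<omega> ^ 3" and ft3: "fourier \<beta>3 \<omega> = x \<omega> ^ 4" if "\<omega> \<noteq> 0" for \<omega>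
    using assms that by (simp_all add: is_bspline_def x_def)
  let ?u2 = "\<lambda>t. \<Sum>i. b (int_decode i) * \<beta>2 (t - of_int (int_decode i))"
  let ?u3 = "\<lambda>t. \<Sum>i. a (int_decode i) * \<beta>3 (t - of_int (int_decode i))"
  have "AE t in lborel. ?u2 t = ?u3 t"
    by (rule AE_eq_of_cross_L2_sums[OF \<beta>2 \<beta>3 cross_shift_comb_tendsto_0[OF _ _ _ a b sum2 sum3]])
       measurable
  then have "fourier ?u2 \<omega> = fourier ?u3 \<omega>" for \<omega>
    unfolding fourier_def by (intro integral_cong_AE) auto
  then have cross: "dtft b \<omega> * fourier \<beta>2 \<omega> = dtft a \<omega> * fourier \<beta>3 \<omega>" for \<omega>
    using fourier_shift_series[OF \<beta>2 b] fourier_shift_series[OF \<beta>3 a] by simp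
  have zero: "dtft b \<omega> = 0" if \<omega>: "0 < \<omega>" "\<omega> < 2 * pi" for \<omega>
  proof -
    define z where "z = 1 - exp (- (\<i> * of_real \<omega>))"
    have z: "z \<noteq> 0"
    proof
      assume "z = 0"
      then have "exp (- (\<i> * of_real \<omega>)) = 1" by (simp add: z_def)
      then obtain n :: int where n: "- \<omega> = of_int (2 * n) * pi" by (auto simp: exp_eq_1)
      have two_pi: "0 < 2 * pi" by simp
      have "0 * (2 * pi) < of_int (- n) * (2 * pi)" "of_int (- n) * (2 * pi) < 1 * (2 * pi)"
        using n \<omega> by (auto simp: algebra_simps)
      then have "0 < (of_int (- n) :: real)" "(of_int (- n) :: real) < 1"
        unfolding mult_less_cancel_right_pos[OF two_pi] by simp_all
      then have "0 < - n" "- n < 1"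
        by (simp_all only: of_int_0_less_iff of_int_less_1_iff)
      then show False by simp
    qed
    have x_shift: "x (\<omega> + 2 * pi) = z / (\<i> * of_real (\<omega> + 2 * pi))"
      using exp_int_frequency_periodic[of \<omega> 1] unfolding x_def z_def by simp
    have x_here: "x \<omega> = z / (\<i> * of_real \<omega>)" by (simp add: x_def z_def)
    \<comment> \<open>The numerator \<open>z\<close> is the same at \<open>\<omega>\<close> and \<open>\<omega> + 2\<pi>\<close>, so both points satisfy this equation.\<close>
    have quot: "dtft b \<eta> * (\<i> * of_real \<eta>) = dtft a \<eta> * z"
      if "\<eta> > 0" "x \<eta> = z / (\<i> * of_real \<eta>)" for \<eta>
    proof -
      have "x \<eta> \<noteq> 0" using z that by simp
      moreover have "dtft b \<eta> * x \<eta> ^ 3 = dtft a \<eta> * x \<eta> * x \<eta> ^ 3"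
        using cross[of \<eta>] that by (simp add: ft2 ft3 power_numeral_reduce)
      ultimately have "dtft b \<eta> = dtft a \<eta> * x \<eta>" by simp
      then show ?thesis using that by simp
    qed
    have "dtft b \<omega> * (\<i> * of_real \<omega>) = dtft b \<omega> * (\<i> * of_real (\<omega> + 2 * pi))"
      using quot[OF \<omega>(1) x_here] quot[OF _ x_shift] \<omega> by (simp add: dtft_periodic)
    \<comment> \<open>The two sides differ by \<open>2\<pi>i\<close> times the value of the symbol.\<close>
    then show ?thesis by (simp add: algebra_simps)
  qed
  have "b k = 0" for k by (rule dtft_eq_0_imp_eq_0[OF b zero])
  then have "sq_norm \<beta>3 = 0"
    using sum3 unfolding has_L2_sum_iff_sq_norm
    by (simp add: shift_comb_def tendsto_const_iff)
  then have "AE t in lborel. \<beta>3 t = 0" by (simp add: sq_norm_eq_0_iff)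
  then have "fourier \<beta>3 pi = 0"
    unfolding fourier_def by (intro integral_eq_zero_AE) auto
  moreover have "exp (- (\<i> * of_real pi)) = -1" by (simp add: exp_minus)
  ultimately show False using ft3[of pi] by (simp add: x_def)
qed

end
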